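(* Let $\mathbb F$ be a field of characteristic different from $2$ and $3$, $W=\mathbb F^3$ and $G=\mathbb Z_2^3$. Let $\sigma\colon G\times G\to \mathrm{Bil}(W\times W,W)$, written $\sigma_{i,j}:=\sigma(g_i,g_j)$, be the map given as follows: for every $i\in I=\{1,\dots,7\}$ and all $r=(a_1,a_2,a_3)$, $s=(b_1,b_2,b_3)\in W$, $$\begin{array}{l}\sigma_{i,i+1}(r,s)=(-a_2b_1-a_3b_3,\,-a_2b_3-a_3b_1,\,a_1b_2),\\ \sigma_{i,i+2}(r,s)=(a_2b_3,\,-a_1b_1-a_3b_2,\,-a_1b_2-a_3b_1),\\ \sigma_{i,i+4}(r,s)=(-a_1b_2-a_2b_3,\,a_3b_1,\,-a_1b_3-a_2b_2),\end{array}$$ $\sigma_{0,i}(r,s)=\sigma_{i,0}(r,s)=\sigma_{0,0}(r,s)=\sigma_{i,i}(r,s)=0$, and $$\sigma_{i,i+3}(r,s)=-\sigma_{i,i+4}(s,r),\quad \sigma_{i,i+5}(r,s)=-\sigma_{i,i+2}(s,r),\quad \sigma_{i,i+6}(r,s)=-\sigma_{i,i+1}(s,r).$$ Then the generalized group algebra $\mathfrak L=W^\sigma[G]$ is a Lie algebra. Furthermore, its center is $\mathfrak z(\mathfrak L)=\{rg_0:r\in W\}$, which has dimension $3$, and its derived algebra $[\mathfrak L,\mathfrak L]$ is the linear span of $\{rg_i:r\in W,\ i\in I\}$ (denoted $W^\sigma[G^\times]$), which is simple and isomorphic to $\mathfrak{so}_7(\mathbb F)$.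
   Context: Generalized group algebra: for an abelian group $(G,+)$, an $\mathbb F$-vector space $W$ and a map $\sigma\colon G\times G\to\mathrm{Bil}(W\times W,W)$, $(g,h)\mapsto\sigma_{g,h}$ (with $\mathrm{Bil}(W\times W,W)$ the bilinear maps $W\times W\to W$), $W^\sigma[G]$ is the vector space of formal sums $\sum_{g\in G}r_g g$, $r_g\in W$ (finitely many nonzero; two are equal iff all coefficients agree), with product obtained by bilinear extension from $(rg)\cdot(sh)=\sigma_{g,h}(r,s)(g+h)$. When this product is a Lie bracket it is written $[\cdot,\cdot]$. Labelling of $G=\mathbb Z_2^3$: $g_0=(0,0,0)$, $g_1=(1,0,0)$, $g_2=(0,1,0)$, $g_3=(0,0,1)$, $g_4=(1,1,0)$, $g_5=(0,1,1)$, $g_6=(1,1,1)$, $g_7=(1,0,1)$. With $I=\{1,\dots,7\}$, sums of indices such as $i+1$, $i+3$ (with $i\in I$) are taken modulo $7$ with values in $I$ (so the residue $0$ is represented by $7$; the index $0$ is distinct and denotes the neutral element). One has $g_i+g_{i+1}=g_{i+3}$ for all $i\in I$. $G^\times=G\setminus\{g_0\}$. $\mathfrak{so}_7(\mathbb F)=\{f\in\mathfrak{gl}_7(\mathbb F):\langle f(x),y\rangle+\langle x,f(y)\rangle=0\ \forall x,y\in\mathbb F^7\}$ for the standard bilinear form $\langle x,y\rangle=\sum x_iy_i$ on $\mathbb F^7$. *)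

theory Defs
  imports "HOL-Analysis.Analysis" "HOL-Library.Poly_Mapping" "HOL-Library.Z2"
begin

section \<open>Lie algebras\<close>

text \<open>A Lie algebra over a field is a subspace \<open>L\<close> of an ambient vector space together with a
  bracket whose behaviour is only prescribed on \<open>L\<close>.\<close>

locale lie_algebra_on = vector_space scl
  for scl :: "'f::field \<Rightarrow> 'v::ab_group_add \<Rightarrow> 'v" +
  fixes L :: "'v set" and bracket :: "'v \<Rightarrow> 'v \<Rightarrow> 'v"
  assumes subspace_L: "subspace L"
    and bracket_closed: "\<lbrakk>x \<in> L; y \<in> L\<rbrakk> \<Longrightarrow> bracket x y \<in> L"
    and bracket_add_left:
      "\<lbrakk>x \<in> L; y \<in> L; z \<in> L\<rbrakk> \<Longrightarrow> bracket (x + y) z = bracket x z + bracket y z"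
    and bracket_add_right:
      "\<lbrakk>x \<in> L; y \<in> L; z \<in> L\<rbrakk> \<Longrightarrow> bracket x (y + z) = bracket x y + bracket x z"
    and bracket_scale_left:
      "\<lbrakk>x \<in> L; y \<in> L\<rbrakk> \<Longrightarrow> bracket (scl c x) y = scl c (bracket x y)"
    and bracket_scale_right:
      "\<lbrakk>x \<in> L; y \<in> L\<rbrakk> \<Longrightarrow> bracket x (scl c y) = scl c (bracket x y)"
    and bracket_self: "x \<in> L \<Longrightarrow> bracket x x = 0"
    and jacobi: "\<lbrakk>x \<in> L; y \<in> L; z \<in> L\<rbrakk> \<Longrightarrow>
      bracket x (bracket y z) + bracket y (bracket z x) + bracket z (bracket x y) = 0"

definition lie_center :: "'v set \<Rightarrow> ('v \<Rightarrow> 'v \<Rightarrow> 'v) \<Rightarrow> 'v::ab_group_add set" where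
  "lie_center L bracket = {x \<in> L. \<forall>y \<in> L. bracket x y = 0}"

definition derived_algebra ::
  "('f::field \<Rightarrow> 'v::ab_group_add \<Rightarrow> 'v) \<Rightarrow> 'v set \<Rightarrow> ('v \<Rightarrow> 'v \<Rightarrow> 'v) \<Rightarrow> 'v set" where
  "derived_algebra scl L bracket = module.span scl {bracket x y | x y. x \<in> L \<and> y \<in> L}"

definition lie_ideal ::
  "('f::field \<Rightarrow> 'v::ab_group_add \<Rightarrow> 'v) \<Rightarrow> 'v set \<Rightarrow> ('v \<Rightarrow> 'v \<Rightarrow> 'v) \<Rightarrow> 'v set \<Rightarrow> bool" where
  "lie_ideal scl L bracket J \<longleftrightarrow>
     J \<subseteq> L \<and> module.subspace scl J \<and> (\<forall>x \<in> L. \<forall>y \<in> J. bracket x y \<in> J)"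

definition simple_lie_algebra ::
  "('f::field \<Rightarrow> 'v::ab_group_add \<Rightarrow> 'v) \<Rightarrow> 'v set \<Rightarrow> ('v \<Rightarrow> 'v \<Rightarrow> 'v) \<Rightarrow> bool" where
  "simple_lie_algebra scl L bracket \<longleftrightarrow>
     lie_algebra_on scl L bracket \<and>
     (\<exists>x \<in> L. \<exists>y \<in> L. bracket x y \<noteq> 0) \<and>
     (\<forall>J. lie_ideal scl L bracket J \<longrightarrow> J = {0} \<or> J = L)"

definition lie_isomorphic ::
  "('f::field \<Rightarrow> 'v::ab_group_add \<Rightarrow> 'v) \<Rightarrow> 'v set \<Rightarrow> ('v \<Rightarrow> 'v \<Rightarrow> 'v) \<Rightarrow>
   ('f \<Rightarrow> 'w::ab_group_add \<Rightarrow> 'w) \<Rightarrow> 'w set \<Rightarrow> ('w \<Rightarrow> 'w \<Rightarrow> 'w) \<Rightarrow> bool" where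
  "lie_isomorphic scl1 L bracket1 scl2 M bracket2 \<longleftrightarrow>
     lie_algebra_on scl1 L bracket1 \<and> lie_algebra_on scl2 M bracket2 \<and>
     (\<exists>\<phi>. bij_betw \<phi> L M \<and>
        (\<forall>x \<in> L. \<forall>y \<in> L. \<phi> (x + y) = \<phi> x + \<phi> y) \<and>
        (\<forall>c. \<forall>x \<in> L. \<phi> (scl1 c x) = scl2 c (\<phi> x)) \<and>
        (\<forall>x \<in> L. \<forall>y \<in> L. \<phi> (bracket1 x y) = bracket2 (\<phi> x) (\<phi> y)))"


section \<open>The orthogonal Lie algebra\<close>

definition std_form :: "'f::field ^ 'n \<Rightarrow> 'f ^ 'n \<Rightarrow> 'f" where
  "std_form x y = (\<Sum>i\<in>UNIV. x $ i * y $ i)"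

definition mat_scale :: "'f::field \<Rightarrow> 'f ^ 'n ^ 'n \<Rightarrow> 'f ^ 'n ^ 'n" where
  "mat_scale c A = (\<chi> i j. c * A $ i $ j)"

definition commutator :: "'f::field ^ 'n ^ 'n \<Rightarrow> 'f ^ 'n ^ 'n \<Rightarrow> 'f ^ 'n ^ 'n" where
  "commutator A B = A ** B - B ** A"

text \<open>An endomorphism of \<open>F\<^sup>7\<close> is represented by its matrix.\<close>

definition so7 :: "('f::field ^ 7 ^ 7) set" where
  "so7 = {A. \<forall>x y. std_form (A *v x) y + std_form x (A *v y) = 0}"


section \<open>Generalized group algebras\<close>

definition bilinear_map ::
  "('f::field \<Rightarrow> 'w::ab_group_add \<Rightarrow> 'w) \<Rightarrow> ('w \<Rightarrow> 'w \<Rightarrow> 'w) \<Rightarrow> bool" where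
  "bilinear_map scl b \<longleftrightarrow>
     (\<forall>r. Vector_Spaces.linear scl scl (b r)) \<and>
     (\<forall>s. Vector_Spaces.linear scl scl (\<lambda>r. b r s))"

text \<open>The formal sums \<open>\<Sum>g. r\<^sub>g g\<close> are the finitely supported functions from the group
  to \<open>W\<close>; the element \<open>r g\<close> is \<open>Poly_Mapping.single g r\<close>. The product is the bilinear extension of
  \<open>(r g) (s h) = \<sigma> g h r s (g + h)\<close>; it does not use the convolution product that the
  library puts on the same type.\<close>

definition gga_scale ::
  "('f \<Rightarrow> 'w \<Rightarrow> 'w) \<Rightarrow> 'f::field \<Rightarrow> ('g \<Rightarrow>\<^sub>0 'w::ab_group_add) \<Rightarrow> ('g \<Rightarrow>\<^sub>0 'w)" where
  "gga_scale scl c = Poly_Mapping.map (scl c)"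

definition gga_mult ::
  "('g \<Rightarrow> 'g \<Rightarrow> 'w \<Rightarrow> 'w \<Rightarrow> 'w) \<Rightarrow>
   ('g::ab_group_add \<Rightarrow>\<^sub>0 'w::ab_group_add) \<Rightarrow> ('g \<Rightarrow>\<^sub>0 'w) \<Rightarrow> ('g \<Rightarrow>\<^sub>0 'w)" where
  "gga_mult \<sigma> x y =
     (\<Sum>g \<in> Poly_Mapping.keys x. \<Sum>h \<in> Poly_Mapping.keys y.
        Poly_Mapping.single (g + h) (\<sigma> g h (Poly_Mapping.lookup x g) (Poly_Mapping.lookup y h)))"

lemma gga_mult_single:
  assumes "bilinear_map scl (\<sigma> g h)"
  shows "gga_mult \<sigma> (Poly_Mapping.single g r) (Poly_Mapping.single h s) =
    Poly_Mapping.single (g + h) (\<sigma> g h r s)"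
proof -
  have l: "Vector_Spaces.linear scl scl (\<sigma> g h r)"
    and l': "Vector_Spaces.linear scl scl (\<lambda>r. \<sigma> g h r s)"
    using assms by (auto simp: bilinear_map_def)
  from l have "module_hom scl scl (\<sigma> g h r)"
    by (simp add: linear_iff_module_hom)
  then have 1: "\<sigma> g h r 0 = 0" by (rule module_hom.zero)
  from l' have "module_hom scl scl (\<lambda>r. \<sigma> g h r s)"
    by (simp add: linear_iff_module_hom)
  then have 2: "\<sigma> g h 0 s = 0" by (rule module_hom.zero)
  show ?thesis using 1 2 by (simp add: gga_mult_def)
qed


section \<open>The twist on \<open>\<int>\<^sub>2\<^sup>3\<close>\<close>

definition gelt :: "nat \<Rightarrow> bit ^ 3" where
  "gelt i = [vector [0,0,0], vector [1,0,0], vector [0,1,0], vector [0,0,1],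
           vector [1,1,0], vector [0,1,1], vector [1,1,1], vector [1,0,1]] ! i"

text \<open>Arguments of \<open>gelt\<close> above 7 are meaningless.\<close>

definition gidx :: "bit ^ 3 \<Rightarrow> nat" where
  "gidx g = (THE i. i \<le> 7 \<and> gelt i = g)"

text \<open>\<open>i \<oplus>\<^sub>7 k\<close> is the sum of indices modulo 7 with representatives in \<open>{1..7}\<close>.\<close>

definition cyc :: "nat \<Rightarrow> nat \<Rightarrow> nat" (infixl \<open>\<oplus>\<^sub>7\<close> 65) where
  "i \<oplus>\<^sub>7 k = (if (i + k) mod 7 = 0 then 7 else (i + k) mod 7)"

definition tau1 :: "'f::field ^ 3 \<Rightarrow> 'f ^ 3 \<Rightarrow> 'f ^ 3" where
  "tau1 a b = vector [- a$2 * b$1 - a$3 * b$3, - a$2 * b$3 - a$3 * b$1, a$1 * b$2]"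

definition tau2 :: "'f::field ^ 3 \<Rightarrow> 'f ^ 3 \<Rightarrow> 'f ^ 3" where
  "tau2 a b = vector [a$2 * b$3, - a$1 * b$1 - a$3 * b$2, - a$1 * b$2 - a$3 * b$1]"

definition tau4 :: "'f::field ^ 3 \<Rightarrow> 'f ^ 3 \<Rightarrow> 'f ^ 3" where
  "tau4 a b = vector [- a$1 * b$2 - a$2 * b$3, a$3 * b$1, - a$1 * b$3 - a$2 * b$2]"

definition twist_idx :: "nat \<Rightarrow> nat \<Rightarrow> 'f::field ^ 3 \<Rightarrow> 'f ^ 3 \<Rightarrow> 'f ^ 3" where
  "twist_idx i j r s =
    (if i = 0 \<or> j = 0 \<or> i = j then 0
     else if j = i \<oplus>\<^sub>7 1 then tau1 r s
     else if j = i \<oplus>\<^sub>7 2 then tau2 r s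
     else if j = i \<oplus>\<^sub>7 4 then tau4 r s
     else if j = i \<oplus>\<^sub>7 3 then - tau4 s r
     else if j = i \<oplus>\<^sub>7 5 then - tau2 s r
     else - tau1 s r)"

definition twist :: "bit ^ 3 \<Rightarrow> bit ^ 3 \<Rightarrow> 'f::field ^ 3 \<Rightarrow> 'f ^ 3 \<Rightarrow> 'f ^ 3" where
  "twist g h = twist_idx (gidx g) (gidx h)"

lemma index_cases:
  assumes "(i::nat) \<in> {1..7}"
  shows "i = 1 \<or> i = 2 \<or> i = 3 \<or> i = 4 \<or> i = 5 \<or> i = 6 \<or> i = 7"
  using assms by auto

lemma gelt_simps:
  "gelt 0 = vector [0,0,0]" "gelt 1 = vector [1,0,0]" "gelt 2 = vector [0,1,0]" "gelt 3 = vector [0,0,1]"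
  "gelt 4 = vector [1,1,0]" "gelt 5 = vector [0,1,1]" "gelt 6 = vector [1,1,1]" "gelt 7 = vector [1,0,1]"
  by (simp_all add: gelt_def)

lemma gelt_bij: "bij_betw gelt {..7} UNIV"
proof -
  have eq: "{..7} = {0,1,2,3,4,5,6,7::nat}" by auto
  have v: "vector [a,b,c] = (vector [a',b',c'] :: bit ^ 3) \<longleftrightarrow> a = a' \<and> b = b' \<and> c = c'"
    for a b c a' b' c'
    by (auto simp: vec_eq_iff forall_3)
  have inj: "inj_on gelt {..7}"
    unfolding eq by (simp add: v gelt_simps del: One_nat_def)
  have "g \<in> gelt ` {..7}" for g
  proof -
    have g: "g = vector [g $ 1, g $ 2, g $ 3]"
      by (simp add: vec_eq_iff forall_3)
    have "g $ 1 = 0 \<or> g $ 1 = 1" "g $ 2 = 0 \<or> g $ 2 = 1" "g $ 3 = 0 \<or> g $ 3 = 1"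
      by (metis bit_not_zero_iff)+
    then show ?thesis unfolding eq
      by (subst g, elim disjE) (simp_all only: image_insert gelt_simps insert_iff simp_thms)
  qed
  with inj show ?thesis by (auto simp: bij_betw_def)
qed

lemma gidx_gl: "i \<le> 7 \<Longrightarrow> gidx (gelt i) = i"
  unfolding gidx_def using gelt_bij
  by (intro the_equality) (auto simp: bij_betw_def inj_on_def)

lemma gelt_zero: "gelt 0 = 0"
  by (simp add: gelt_def vec_eq_iff forall_3)

lemma gelt_add: "i \<in> {1..7} \<Longrightarrow> gelt i + gelt (i \<oplus>\<^sub>7 1) = gelt (i \<oplus>\<^sub>7 3)"
  by (drule index_cases, elim disjE; hypsubst; simp add: cyc_def del: One_nat_def;
      simp add: gelt_simps gelt_simps(2)[unfolded One_nat_def] vec_eq_iff forall_3)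

lemma twist_gelt: "\<lbrakk>i \<le> 7; j \<le> 7\<rbrakk> \<Longrightarrow> twist (gelt i) (gelt j) = twist_idx i j"
  by (intro ext) (simp add: twist_def gidx_gl)

lemma cyc_le [simp]: "i \<oplus>\<^sub>7 k \<le> 7"
  using less_imp_le[OF mod_less_divisor[of 7 "i + k"]] by (simp add: cyc_def)

lemma cyc_pos [simp]: "i \<oplus>\<^sub>7 k \<noteq> 0"
  by (simp add: cyc_def)

lemma cyc_eq_iff:
  assumes "k < 7" "l < 7"
  shows "i \<oplus>\<^sub>7 k = i \<oplus>\<^sub>7 l \<longleftrightarrow> k = l"
proof -
  have *: "k = l" if "(i + k) mod 7 = (i + l) mod 7" "k < 7" "l < 7" "k \<le> l" for k l
  proof -
    have "7 dvd (i + l) - (i + k)"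
      using that by (metis mod_eq_dvd_iff_nat add_left_mono)
    then show ?thesis using that by (auto dest: dvd_imp_le)
  qed
  have m: "(i \<oplus>\<^sub>7 k) mod 7 = (i + k) mod 7" for k
    by (simp add: cyc_def)
  show ?thesis
    using *[of k l] *[of l k] assms m[of k] m[of l] by (metis nat_le_linear)
qed

lemma eq_cyc_iff:
  assumes "i \<in> {1..7}" "k < 7"
  shows "i = i \<oplus>\<^sub>7 k \<longleftrightarrow> k = 0"
proof -
  have "i \<oplus>\<^sub>7 0 = i"
    using index_cases[OF assms(1)] by (elim disjE) (simp_all add: cyc_def)
  then show ?thesis using cyc_eq_iff[of 0 k i] assms(2) by auto
qed

lemma twist_zero:
  "i \<in> {1..7} \<Longrightarrow> twist (gelt 0) (gelt i) r s = 0"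
  "i \<in> {1..7} \<Longrightarrow> twist (gelt i) (gelt 0) r s = 0"
  "twist (gelt 0) (gelt 0) r s = 0"
  "i \<in> {1..7} \<Longrightarrow> twist (gelt i) (gelt i) r s = 0"
  by (simp_all add: twist_gelt twist_idx_def)

lemma twist_pos:
  fixes a1 a2 a3 b1 b2 b3 :: "'f::field"
  assumes "i \<in> {1..7}"
  defines "r \<equiv> vector [a1, a2, a3] :: 'f ^ 3" and "s \<equiv> vector [b1, b2, b3] :: 'f ^ 3"
  shows "twist (gelt i) (gelt (i \<oplus>\<^sub>7 1)) r s =
      vector [- a2 * b1 - a3 * b3, - a2 * b3 - a3 * b1, a1 * b2]"
    and "twist (gelt i) (gelt (i \<oplus>\<^sub>7 2)) r s =
      vector [a2 * b3, - a1 * b1 - a3 * b2, - a1 * b2 - a3 * b1]"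
    and "twist (gelt i) (gelt (i \<oplus>\<^sub>7 4)) r s =
      vector [- a1 * b2 - a2 * b3, a3 * b1, - a1 * b3 - a2 * b2]"
  using assms(1)
  by (simp_all add: r_def s_def twist_gelt twist_idx_def cyc_eq_iff eq_cyc_iff
      tau1_def tau2_def tau4_def)

lemma twist_neg:
  assumes "i \<in> {1..7}"
  shows "twist (gelt i) (gelt (i \<oplus>\<^sub>7 3)) r s = - twist (gelt i) (gelt (i \<oplus>\<^sub>7 4)) s r"
    and "twist (gelt i) (gelt (i \<oplus>\<^sub>7 5)) r s = - twist (gelt i) (gelt (i \<oplus>\<^sub>7 2)) s r"
    and "twist (gelt i) (gelt (i \<oplus>\<^sub>7 6)) r s = - twist (gelt i) (gelt (i \<oplus>\<^sub>7 1)) s r"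
  using assms by (simp_all add: twist_gelt twist_idx_def cyc_eq_iff eq_cyc_iff)

lemma tau_bilinear:
  "tau1 (r + r') s = tau1 r s + tau1 r' s" "tau1 r (s + s') = tau1 r s + tau1 r s'"
  "tau1 (c *s r) s = c *s tau1 r s" "tau1 r (c *s s) = c *s tau1 r s"
  "tau2 (r + r') s = tau2 r s + tau2 r' s" "tau2 r (s + s') = tau2 r s + tau2 r s'"
  "tau2 (c *s r) s = c *s tau2 r s" "tau2 r (c *s s) = c *s tau2 r s"
  "tau4 (r + r') s = tau4 r s + tau4 r' s" "tau4 r (s + s') = tau4 r s + tau4 r s'"
  "tau4 (c *s r) s = c *s tau4 r s" "tau4 r (c *s s) = c *s tau4 r s"
  by (simp_all add: tau1_def tau2_def tau4_def vec_eq_iff forall_3 algebra_simps)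

lemma bilinear_twist: "bilinear_map (*s) (twist g h)"
proof -
  have "vector_space ((*s) :: 'a \<Rightarrow> 'a ^ 3 \<Rightarrow> 'a ^ 3)"
    by (rule vec.vector_space_axioms)
  then show ?thesis
    by (simp add: bilinear_map_def Vector_Spaces.linear_iff twist_def twist_idx_def tau_bilinear)
qed

type_synonym 'f galg = "(bit ^ 3) \<Rightarrow>\<^sub>0 ('f ^ 3)"

abbreviation galg_scale :: "'f::field \<Rightarrow> 'f galg \<Rightarrow> 'f galg" where
  "galg_scale \<equiv> gga_scale (*s)"

abbreviation galg_bracket :: "'f::field galg \<Rightarrow> 'f galg \<Rightarrow> 'f galg" where
  "galg_bracket \<equiv> gga_mult twist"

end

theory Submission
  imports Defs
begin

text \<open>The seven nonzero elements \<open>g\<^sub>i\<close> of the group also index the rows and columns of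
  \<open>7 \<times> 7\<close> matrices, so that the skew matrix \<open>E\<^sub>p\<^sub>q - E\<^sub>q\<^sub>p\<close> has degree \<open>g\<^sub>p + g\<^sub>q\<close>. The
  three pairs of degree \<open>g\<^sub>i\<close> come from the three lines through \<open>i\<close> in the Fano plane, namely
  \<open>{i+1, i+3}\<close>, \<open>{i+2, i+6}\<close> and \<open>{i+4, i+5}\<close>, and they match the three coordinates of \<open>W\<close>: the
  twist is the commutator written in this basis. Sending coefficients to matrix entries
  therefore turns the product into the commutator, with kernel \<open>W g\<^sub>0\<close>. As no product has a
  \<open>g\<^sub>0\<close>-component, the Lie axioms and all structural claims are pulled back from skew
  matrices.\<close>

section \<open>The group elements indexed by residues modulo 7\<close>

text \<open>Index offsets below arise as sums of two residues; these rules reduce the resulting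
  numerals modulo 7.\<close>

lemma numeral_7:
  "(7::7) = 0" "(8::7) = 1" "(9::7) = 2" "(10::7) = 3" "(11::7) = 4" "(12::7) = 5"
  by simp_all

text \<open>The type \<open>7\<close> is a ring, so cyclic index sums become ordinary addition. Its
  element 0 receives the label 7; the label 0 stays reserved for the neutral element.\<close>

definition lab :: "7 \<Rightarrow> nat" where
  "lab = inv_into {1..7} of_nat"

lemma bij_of_nat_7: "bij_betw (of_nat :: nat \<Rightarrow> 7) {1..7} UNIV"
proof -
  have eq: "{1..7} = {1,2,3,4,5,6,7::nat}" by auto
  have "inj_on (of_nat :: nat \<Rightarrow> 7) {1..7}"
    unfolding eq by (simp del: One_nat_def)
  moreover from this have "of_nat ` {1..7} = (UNIV :: 7 set)"
    by (intro card_subset_eq) (simp_all add: card_image)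
  ultimately show ?thesis by (simp add: bij_betw_def)
qed

lemma bij_lab: "bij_betw lab UNIV {1..7}"
  unfolding lab_def by (rule bij_betw_inv_into[OF bij_of_nat_7])

lemma lab_in: "lab i \<in> {1..7}"
  using bij_lab by (auto simp: bij_betw_def)

lemma of_nat_lab: "of_nat (lab i) = i"
  using bij_betw_inv_into_right[OF bij_of_nat_7] by (simp add: lab_def)

lemma lab_of_nat: "n \<in> {1..7} \<Longrightarrow> lab (of_nat n) = n"
  using bij_betw_inv_into_left[OF bij_of_nat_7] by (simp add: lab_def)

text \<open>Replacing the remainder 0 by 7 is harmless because 7 is 0 in the type
  \<open>7\<close>.\<close>

lemma of_nat_cyc: "of_nat (i \<oplus>\<^sub>7 k) = (of_nat (i + k) :: 7)"
proof -
  have "of_nat n = (of_nat (n mod 7) :: 7)" for n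
  proof -
    have "of_nat n = (of_nat (7 * (n div 7) + n mod 7) :: 7)" by simp
    also have "\<dots> = of_nat (n mod 7)"
      by (simp only: of_nat_add of_nat_mult of_nat_numeral numeral_7) simp
    finally show ?thesis .
  qed
  from this[of "i + k"] show ?thesis by (simp add: cyc_def)
qed

lemma lab_add: "lab (i + of_nat k) = lab i \<oplus>\<^sub>7 k"
proof -
  have "i + of_nat k = of_nat (lab i \<oplus>\<^sub>7 k)"
    by (simp add: of_nat_cyc of_nat_lab)
  moreover have "lab i \<oplus>\<^sub>7 k \<in> {1..7}"
    using cyc_le[of "lab i" k] cyc_pos[of "lab i" k] by (simp del: cyc_le cyc_pos)
  ultimately show ?thesis by (simp only: lab_of_nat)
qed

lemma lab_add_numeral:
  "lab (i + 1) = lab i \<oplus>\<^sub>7 1" "lab (i + numeral k) = lab i \<oplus>\<^sub>7 numeral k"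
  using lab_add[of i 1] lab_add[of i "numeral k"] by simp_all

definition gz :: "7 \<Rightarrow> bit ^ 3" where
  "gz i = gelt (lab i)"

lemma bij_gz: "bij_betw gz UNIV (- {0})"
proof -
  have "bij_betw gelt ({..7} - {0}) (UNIV - {gelt 0})"
    by (rule bij_betw_DiffI[OF gelt_bij]) (auto simp: bij_betw_def)
  moreover have "{..7} - {0} = {1..7::nat}" by auto
  moreover have "gz = gelt \<circ> lab" by (simp add: gz_def fun_eq_iff)
  ultimately show ?thesis
    using bij_betw_trans[OF bij_lab] by (metis gelt_zero Compl_eq_Diff_UNIV)
qed

lemma inj_gz: "gz i = gz j \<longleftrightarrow> i = j"
  using bij_gz by (auto simp: bij_betw_def inj_on_def)

lemma gz_nonzero: "gz i \<noteq> 0"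
  using bij_gz by (auto simp: bij_betw_def)

lemma gz_cases: obtains "g = 0" | i where "g = gz i"
  using bij_gz by (auto simp: bij_betw_def)

lemma image_gelt: "gelt ` {1..7} = range gz"
proof -
  have "range gz = gelt ` range lab" by (auto simp: gz_def)
  then show ?thesis using bij_lab by (simp add: bij_betw_def)
qed

section \<open>Addition in the group and the lines of the Fano plane\<close>

lemma z2_add_self: "g + g = (0 :: bit ^ 3)"
  by (simp add: vec_eq_iff)

text \<open>Every element is its own inverse, so the relation along a Fano line may be read in any
  order of its three points.\<close>

lemma z2_add_eq: "a + b = c \<Longrightarrow> a + c = (b :: bit ^ 3)"
  by (auto simp: add.assoc[symmetric] z2_add_self)

lemma z2_diff: "a - b = (a + b :: bit ^ 3)"
  by (simp add: diff_eq_eq add.assoc z2_add_self)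

lemma gz_add_1: "gz i + gz (i + 1) = gz (i + 3)"
  using gelt_add[OF lab_in] by (simp add: gz_def lab_add_numeral)

lemma gz_add:
  "gz i + gz (i + 1) = gz (i + 3)"
  "gz i + gz (i + 2) = gz (i + 6)"
  "gz i + gz (i + 3) = gz (i + 1)"
  "gz i + gz (i + 4) = gz (i + 5)"
  "gz i + gz (i + 5) = gz (i + 4)"
  "gz i + gz (i + 6) = gz (i + 2)"
proof -
  \<comment> \<open>The instances at \<open>i\<close>, \<open>i + 6\<close> and \<open>i + 4\<close>
    are the three Fano lines through \<open>i\<close>.\<close>
  note l = gz_add_1[of i] gz_add_1[of "i + 6"] gz_add_1[of "i + 4"]
  have n: "i + 6 + 1 = i" "i + 6 + 3 = i + 2" "i + 4 + 1 = i + 5" "i + 4 + 3 = i"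
    by (simp_all add: add.assoc)
  note l' = l[unfolded n]
  show "gz i + gz (i + 1) = gz (i + 3)" "gz i + gz (i + 3) = gz (i + 1)"
    "gz i + gz (i + 6) = gz (i + 2)" "gz i + gz (i + 2) = gz (i + 6)"
    "gz i + gz (i + 4) = gz (i + 5)" "gz i + gz (i + 5) = gz (i + 4)"
    using l' by (metis z2_add_eq add.commute)+
qed

lemma twist_gz:
  "twist (gz i) (gz i) r s = 0"
  "twist (gz i) (gz (i + 1)) r s = tau1 r s"
  "twist (gz i) (gz (i + 2)) r s = tau2 r s"
  "twist (gz i) (gz (i + 3)) r s = - tau4 s r"
  "twist (gz i) (gz (i + 4)) r s = tau4 r s"
  "twist (gz i) (gz (i + 5)) r s = - tau2 s r"
  "twist (gz i) (gz (i + 6)) r s = - tau1 s r"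
  using lab_in[of i]
  by (simp_all add: gz_def lab_add_numeral twist_gelt twist_idx_def cyc_eq_iff eq_cyc_iff)

lemma twist_0: "twist 0 g r s = 0" "twist g 0 r s = 0"
  using gidx_gl[of 0] by (simp_all add: twist_def twist_idx_def gelt_zero)

lemma finite_z2: "finite (UNIV :: (bit ^ 3) set)"
  using gelt_bij bij_betw_finite by blast

lemma sum_z2: "sum f (UNIV :: (bit ^ 3) set) = f 0 + (\<Sum>i\<in>UNIV. f (gz i))"
  by (subst sum.remove[of _ 0])
    (simp_all add: finite_z2 Compl_eq_Diff_UNIV[symmetric] sum.reindex_bij_betw[OF bij_gz])

lemma UNIV_7: "UNIV = {0, 1, 2, 3, 4, 5, 6 :: 7}"
  by (rule sym, rule card_subset_eq) simp_all

text \<open>Starting the cyclic sum at a chosen \<open>i\<close> puts every summand at a fixed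
  offset from \<open>i\<close>, the form in which \<open>gz_add\<close> and \<open>twist_gz\<close>
  apply.\<close>

lemma sum_7: "sum f UNIV = f i + f (i + 1) + f (i + 2) + f (i + 3) + f (i + 4) + f (i + 5) + f (i + 6 :: 7)"
proof -
  have "sum f UNIV = (\<Sum>j\<in>UNIV. f (i + j))"
    by (rule sum.reindex_bij_witness[of _ "\<lambda>j. i + j" "\<lambda>j. j - i"]) auto
  also have "\<dots> = (\<Sum>j\<in>{0, 1, 2, 3, 4, 5, 6}. f (i + j))"
    by (simp only: UNIV_7)
  finally show ?thesis by (simp add: add.assoc)
qed

section \<open>The product in coordinates\<close>

lemma bilinear_map_zero:
  assumes "bilinear_map scl b"
  shows "b 0 s = 0" "b r 0 = 0"
proof -
  have "module_hom scl scl (b r)" "module_hom scl scl (\<lambda>r. b r s)"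
    using assms by (auto simp: bilinear_map_def linear_iff_module_hom)
  then show "b 0 s = 0" "b r 0 = 0"
    by (auto dest: module_hom.zero)
qed

text \<open>Bilinearity kills the terms outside the supports, so both sums may run over the whole
  finite group; the coefficient at \<open>k\<close> then keeps only
  \<open>h = k - g\<close>.\<close>

lemma lookup_gga_mult:
  fixes \<sigma> :: "'g::ab_group_add \<Rightarrow> 'g \<Rightarrow> 'w::ab_group_add \<Rightarrow> 'w \<Rightarrow> 'w"
  assumes "\<And>g h. bilinear_map scl (\<sigma> g h)" and fin: "finite (UNIV :: 'g set)"
  shows "Poly_Mapping.lookup (gga_mult \<sigma> x y) k =
    (\<Sum>g\<in>UNIV. \<sigma> g (k - g) (Poly_Mapping.lookup x g) (Poly_Mapping.lookup y (k - g)))"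
proof -
  have z: "\<sigma> g h 0 s = 0" "\<sigma> g h r 0 = 0" for g h r s
    by (rule bilinear_map_zero[OF assms(1)])+
  have "gga_mult \<sigma> x y = (\<Sum>g\<in>UNIV. \<Sum>h\<in>UNIV.
      Poly_Mapping.single (g + h) (\<sigma> g h (Poly_Mapping.lookup x g) (Poly_Mapping.lookup y h)))"
    unfolding gga_mult_def
    by (intro sum.mono_neutral_cong_left ballI sum.mono_neutral_left sum.neutral)
      (auto simp: z in_keys_iff intro: fin finite_subset[OF subset_UNIV])
  also have "Poly_Mapping.lookup \<dots> k = (\<Sum>g\<in>UNIV. \<Sum>h\<in>UNIV. if h = k - g then
      \<sigma> g h (Poly_Mapping.lookup x g) (Poly_Mapping.lookup y h) else 0)"
    by (auto simp: lookup_sum lookup_single when_def algebra_simps intro!: sum.cong)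
  finally show ?thesis by (simp add: fin)
qed

text \<open>A product lands in degree 0 only for equal degrees, since \<open>g + h = 0\<close>
  forces \<open>g = h\<close>, and there the twist vanishes.\<close>

lemma lookup_bracket_0: "Poly_Mapping.lookup (galg_bracket x y) 0 = 0"
  by (simp add: lookup_gga_mult[OF bilinear_twist finite_z2] z2_diff sum_z2 twist_0 twist_gz)

abbreviation coord :: "'f::field galg \<Rightarrow> 7 \<Rightarrow> 'f ^ 3" where
  "coord x i \<equiv> Poly_Mapping.lookup x (gz i)"

text \<open>The three index pairs of degree \<open>gz i\<close>, each taken in the order for which
  the twist is \<open>tau1\<close>, \<open>tau2\<close> or \<open>tau4\<close>. The reversed orders
  give the negatives with exchanged arguments.\<close>

definition half_bracket :: "'f::field galg \<Rightarrow> 'f galg \<Rightarrow> 7 \<Rightarrow> 'f ^ 3" where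
  "half_bracket x y i = tau1 (coord x (i + 4)) (coord y (i + 5))
    + tau2 (coord x (i + 1)) (coord y (i + 3)) + tau4 (coord x (i + 2)) (coord y (i + 6))"

lemma coord_bracket:
  "coord (galg_bracket x y) i = half_bracket x y i - half_bracket y x i"
proof -
  \<comment> \<open>The offset is 2 from \<open>i + 1\<close> to \<open>i + 3\<close>, 4 from
    \<open>i + 2\<close> to \<open>i + 6\<close> and 1 from \<open>i + 4\<close> to
    \<open>i + 5\<close>; the reversed offsets are 5, 3 and 6.\<close>
  have t: "twist (gz (i + 1)) (gz (i + 3)) r s = tau2 r s"
      "twist (gz (i + 3)) (gz (i + 1)) r s = - tau2 s r"
      "twist (gz (i + 2)) (gz (i + 6)) r s = tau4 r s"
      "twist (gz (i + 6)) (gz (i + 2)) r s = - tau4 s r"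
      "twist (gz (i + 4)) (gz (i + 5)) r s = tau1 r s"
      "twist (gz (i + 5)) (gz (i + 4)) r s = - tau1 s r" for r s :: "'a ^ 3"
    using twist_gz(3)[of "i + 1" r s] twist_gz(6)[of "i + 3" r s] twist_gz(5)[of "i + 2" r s]
      twist_gz(4)[of "i + 6" r s] twist_gz(2)[of "i + 4" r s] twist_gz(7)[of "i + 5" r s]
    by (simp_all add: add.assoc numeral_7)
  have "coord (galg_bracket x y) i = (\<Sum>j\<in>UNIV.
      twist (gz j) (gz i + gz j) (coord x j) (Poly_Mapping.lookup y (gz i + gz j)))"
    by (simp only: lookup_gga_mult[OF bilinear_twist finite_z2] z2_diff sum_z2 twist_0 add_0)
  also have "\<dots> = half_bracket x y i - half_bracket y x i"
    by (simp only: sum_7[of _ i] gz_add z2_add_self twist_0 t half_bracket_def) simp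
  finally show ?thesis .
qed

section \<open>Skew matrices\<close>

text \<open>One direction evaluates the form at standard basis vectors; the other moves
  \<open>A\<close> across the form by interchanging the double sum.\<close>

lemma in_so7_iff: "A \<in> so7 \<longleftrightarrow> (\<forall>p q. A $ p $ q = - A $ q $ p)"
proof
  assume A: "A \<in> so7"
  have "std_form (A *v axis q 1) (axis p 1) = A $ p $ q"
    "std_form (axis p 1) (A *v axis q 1) = A $ p $ q" for p q
    by (simp_all add: std_form_def matrix_vector_mult_def axis_def if_distrib[of "(*) _"]
        if_distrib[of "\<lambda>x. x * _"] cong: if_cong)
  then have "A $ p $ q + A $ q $ p = 0" for p q
    using A unfolding so7_def by (metis (mono_tags, lifting) mem_Collect_eq)
  then show "\<forall>p q. A $ p $ q = - A $ q $ p"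
    by (simp add: eq_neg_iff_add_eq_0)
next
  assume A: "\<forall>p q. A $ p $ q = - A $ q $ p"
  have "std_form (A *v x) y + std_form x (A *v y) = 0" for x y
  proof -
    have "std_form (A *v x) y = (\<Sum>p\<in>UNIV. \<Sum>q\<in>UNIV. A $ p $ q * x $ q * y $ p)"
      by (simp add: std_form_def matrix_vector_mult_def sum_distrib_right)
    also have "\<dots> = (\<Sum>q\<in>UNIV. \<Sum>p\<in>UNIV. A $ p $ q * x $ q * y $ p)"
      by (rule sum.swap)
    also have "\<dots> = (\<Sum>q\<in>UNIV. \<Sum>p\<in>UNIV. - (x $ q * (A $ q $ p * y $ p)))"
    proof (intro sum.cong refl)
      fix p q
      show "A $ p $ q * x $ q * y $ p = - (x $ q * (A $ q $ p * y $ p))"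
        using A[rule_format, of p q] by (simp add: ac_simps)
    qed
    also have "\<dots> = - std_form x (A *v y)"
      by (simp add: std_form_def matrix_vector_mult_def sum_distrib_left sum_negf)
    finally show ?thesis by simp
  qed
  then show "A \<in> so7" by (simp add: so7_def)
qed

lemma commutator_component:
  "commutator A B $ p $ q = (\<Sum>r\<in>UNIV. A $ p $ r * B $ r $ q - B $ p $ r * A $ r $ q)"
  by (simp add: commutator_def matrix_matrix_mult_def sum_subtractf)

text \<open>Skewness holds summand by summand: in \<open>A $ p $ r * B $ r $ q\<close> the two sign
  changes cancel, leaving \<open>B $ q $ r * A $ r $ p\<close>.\<close>

lemma commutator_so7:
  assumes "A \<in> so7" "B \<in> so7" shows "commutator A B \<in> so7"
proof -
  have "A $ p $ r * B $ r $ q - B $ p $ r * A $ r $ q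
      = - (A $ q $ r * B $ r $ p - B $ q $ r * A $ r $ p)" for p q r
  proof -
    have "A $ p $ r = - A $ r $ p" "B $ r $ q = - B $ q $ r" "B $ p $ r = - B $ r $ p" "A $ r $ q = - A $ q $ r"
      using assms unfolding in_so7_iff by blast+
    then show ?thesis by (simp add: ac_simps)
  qed
  then show ?thesis
    unfolding in_so7_iff commutator_component sum_negf[symmetric] by (intro allI sum.cong refl)
qed

lemma commutator_jacobi:
  "commutator A (commutator B C) + commutator B (commutator C A) + commutator C (commutator A B) = 0"
proof -
  have "A ** (B - C) = A ** B - A ** C" "(A - B) ** C = A ** C - B ** C" for A B C :: "'a^'b^'b"
    by (simp_all add: matrix_matrix_mult_def vec_eq_iff sum_subtractf algebra_simps)
  then show ?thesis by (simp add: commutator_def matrix_mul_assoc)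
qed

lemma vector_space_mat_scale: "vector_space mat_scale"
  by unfold_locales (simp_all add: mat_scale_def vec_eq_iff algebra_simps)

lemma commutator_bilinear:
  "commutator (A + A') B = commutator A B + commutator A' B"
  "commutator A (B + B') = commutator A B + commutator A B'"
  "commutator (mat_scale c A) B = mat_scale c (commutator A B)"
  "commutator A (mat_scale c B) = mat_scale c (commutator A B)"
  by (simp_all add: vec_eq_iff commutator_component mat_scale_def sum_distrib_left
      sum.distrib sum_subtractf ring_distribs mult_ac)

lemma lie_algebra_so7: "lie_algebra_on mat_scale (so7 :: ('f::field ^ 7 ^ 7) set) commutator"
proof -
  interpret vector_space "mat_scale :: 'f \<Rightarrow> 'f ^ 7 ^ 7 \<Rightarrow> 'f ^ 7 ^ 7" by (rule vector_space_mat_scale)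
  show ?thesis
  proof
    show "subspace so7"
    proof (rule subspaceI)
      fix A B :: "'f ^ 7 ^ 7"
      assume "A \<in> so7" "B \<in> so7"
      then have skew: "A $ p $ q = - A $ q $ p" "B $ p $ q = - B $ q $ p" for p q
        unfolding in_so7_iff by blast+
      have "(A + B) $ p $ q = - (A + B) $ q $ p" for p q
        using skew[of p q] by simp
      then show "A + B \<in> so7" unfolding in_so7_iff by blast
    next
      fix c and A :: "'f ^ 7 ^ 7"
      assume "A \<in> so7"
      then have skew: "A $ p $ q = - A $ q $ p" for p q
        unfolding in_so7_iff by blast
      have "mat_scale c A $ p $ q = - mat_scale c A $ q $ p" for p q
        using skew[of p q] by (simp add: mat_scale_def)
      then show "mat_scale c A \<in> so7" unfolding in_so7_iff by blast
    qed (simp add: in_so7_iff)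
  qed (simp_all add: commutator_so7 commutator_bilinear commutator_jacobi, simp add: commutator_def)
qed

section \<open>The vector space structure of the group algebra\<close>

lemma lookup_gga_scale:
  "Poly_Mapping.lookup (galg_scale c x) g = c *s Poly_Mapping.lookup x g"
  by (simp add: gga_scale_def map.rep_eq when_def)

lemma vector_space_galg_scale: "vector_space galg_scale"
  by unfold_locales
    (simp_all add: poly_mapping_eq_iff fun_eq_iff lookup_gga_scale lookup_add
      vec.scale_left_distrib vec.scale_right_distrib)

section \<open>The homomorphism to skew matrices\<close>

text \<open>The coordinates at \<open>gz i\<close> become the entries \<open>(i+3, i+1)\<close>, \<open>(i+6, i+2)\<close> and
  \<open>(i+5, i+4)\<close>. With this orientation of the pairs all signs are \<open>+1\<close>.\<close>

definition lower_entry :: "'f::field galg \<Rightarrow> 7 \<Rightarrow> 7 \<Rightarrow> 'f" where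
  "lower_entry x p q =
    (if p = q + 2 then coord x (q + 6) $ 1
     else if p = q + 4 then coord x (q + 5) $ 2
     else if p = q + 1 then coord x (q + 3) $ 3
     else 0)"

text \<open>The offsets 1, 2, 4 and their negatives 6, 5, 3 exhaust the nonzero residues modulo 7,
  so each pair of distinct indices is filled exactly once and the two terms never overlap.\<close>

definition so7_of :: "'f::field galg \<Rightarrow> 'f ^ 7 ^ 7" where
  "so7_of x = (\<chi> p q. lower_entry x p q - lower_entry x q p)"

lemma so7_of_component: "so7_of x $ p $ q = lower_entry x p q - lower_entry x q p"
  by (simp add: so7_of_def)

lemma so7_of_in_so7: "so7_of x \<in> so7"
  by (simp add: in_so7_iff so7_of_component)

lemma so7_of_entries:
  "so7_of x $ (q + 1) $ q = coord x (q + 3) $ 3"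
  "so7_of x $ (q + 2) $ q = coord x (q + 6) $ 1"
  "so7_of x $ (q + 4) $ q = coord x (q + 5) $ 2"
  by (simp_all add: so7_of_component lower_entry_def add.assoc)

text \<open>Skewness gives only \<open>2 * A $ p $ p = 0\<close>; the condition on the
  characteristic enters here.\<close>

lemma so7_diag:
  assumes "(2 :: 'f::field) \<noteq> 0" "A \<in> so7" shows "A $ p $ p = (0 :: 'f)"
proof -
  have "A $ p $ p = - A $ p $ p" using assms(2) unfolding in_so7_iff by blast
  then have "2 * A $ p $ p = 0" by (simp only: mult_2 eq_neg_iff_add_eq_0)
  then show ?thesis using assms(1) by simp
qed

text \<open>The offsets 3, 5, 6 are the negatives of 4, 2, 1 and follow by skewness; offset 0 is the
  vanishing diagonal.\<close>

lemma so7_eqI: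
  assumes two: "(2 :: 'f::field) \<noteq> 0" and A: "A \<in> so7" and B: "B \<in> so7"
    and "\<And>q. A $ (q + 1) $ q = B $ (q + 1) $ q"
    and "\<And>q. A $ (q + 2) $ q = B $ (q + 2) $ q"
    and "\<And>q. A $ (q + 4) $ q = B $ (q + 4) $ q"
  shows "A = (B :: 'f ^ 7 ^ 7)"
proof -
  have skew: "A $ p $ q = - A $ q $ p" "B $ p $ q = - B $ q $ p" for p q
    using A B unfolding in_so7_iff by blast+
  have upper: "A $ q $ (q + d) = B $ q $ (q + d)" if "d \<in> {1, 2, 4}" for q d
  proof -
    have "A $ (q + d) $ q = B $ (q + d) $ q" using that assms(4-6) by auto
    then show ?thesis by (simp only: skew(1)[of q] skew(2)[of q])
  qed
  have "A $ (q + d) $ q = B $ (q + d) $ q" for q d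
  proof -
    have "d \<in> {0, 1, 2, 3, 4, 5, 6}" using UNIV_7 by auto
    then consider "d = 0" | "d \<in> {1, 2, 4}" | "d = 3" | "d = 5" | "d = 6" by blast
    then show ?thesis
    proof cases
      case 1
      then show ?thesis using so7_diag[OF two A] so7_diag[OF two B] by simp
    next
      case 2
      then show ?thesis using assms(4-6) by auto
    next
      case 3
      then show ?thesis using upper[of 4 "q + 3"] by (simp add: add.assoc numeral_7)
    next
      case 4
      then show ?thesis using upper[of 2 "q + 5"] by (simp add: add.assoc numeral_7)
    next
      case 5
      then show ?thesis using upper[of 1 "q + 6"] by (simp add: add.assoc numeral_7)
    qed
  qed
  from this[of q "p - q" for p q] have "A $ p $ q = B $ p $ q" for p q
    by simp
  then show ?thesis by (simp add: vec_eq_iff)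
qed

lemma tau_components:
  "tau1 a b $ 1 = - a$2 * b$1 - a$3 * b$3" "tau1 a b $ 2 = - a$2 * b$3 - a$3 * b$1"
  "tau1 a b $ 3 = a$1 * b$2"
  "tau2 a b $ 1 = a$2 * b$3" "tau2 a b $ 2 = - a$1 * b$1 - a$3 * b$2"
  "tau2 a b $ 3 = - a$1 * b$2 - a$3 * b$1"
  "tau4 a b $ 1 = - a$1 * b$2 - a$2 * b$3" "tau4 a b $ 2 = a$3 * b$1"
  "tau4 a b $ 3 = - a$1 * b$3 - a$2 * b$2"
  by (simp_all add: tau1_def tau2_def tau4_def)

text \<open>By \<open>so7_eqI\<close> three families of entries suffice. In each, the five summation
  indices different from row and column contribute ten products, which match the ten monomials of
  the corresponding component of \<open>half_bracket x y q' - half_bracket y x q'\<close>, with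
  \<open>q'\<close> the degree index of the entry.\<close>

lemma so7_of_bracket:
  assumes two: "(2 :: 'f::field) \<noteq> 0"
  shows "so7_of (galg_bracket x y) = commutator (so7_of x) (so7_of (y :: 'f galg))"
proof (rule so7_eqI[OF two so7_of_in_so7 commutator_so7[OF so7_of_in_so7 so7_of_in_so7]])
  fix q :: 7
  \<comment> \<open>Expanding the sum from \<open>q\<close> makes all indices fixed offsets of
    \<open>q\<close>, so every case distinction in \<open>lower_entry\<close> is decided.\<close>
  show "so7_of (galg_bracket x y) $ (q + 1) $ q = commutator (so7_of x) (so7_of y) $ (q + 1) $ q"
    unfolding so7_of_entries coord_bracket half_bracket_def commutator_component sum_7[of _ q]
      so7_of_component lower_entry_def
    by (simp add: add.assoc numeral_7 tau_components)
  show "so7_of (galg_bracket x y) $ (q + 2) $ q = commutator (so7_of x) (so7_of y) $ (q + 2) $ q"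
    unfolding so7_of_entries coord_bracket half_bracket_def commutator_component sum_7[of _ q]
      so7_of_component lower_entry_def
    by (simp add: add.assoc numeral_7 tau_components)
  show "so7_of (galg_bracket x y) $ (q + 4) $ q = commutator (so7_of x) (so7_of y) $ (q + 4) $ q"
    unfolding so7_of_entries coord_bracket half_bracket_def commutator_component sum_7[of _ q]
      so7_of_component lower_entry_def
    by (simp add: add.assoc numeral_7 tau_components)
qed

lemma so7_of_linear:
  "so7_of (x + y) = so7_of x + so7_of y"
  "so7_of (galg_scale c x) = mat_scale c (so7_of x)"
  by (simp_all add: vec_eq_iff so7_of_component lower_entry_def mat_scale_def lookup_add
      lookup_gga_scale algebra_simps)

lemma so7_of_0: "so7_of 0 = 0"
  by (simp add: vec_eq_iff so7_of_component lower_entry_def)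

text \<open>The part of nonzero degree, encoded by one vanishing coefficient to make membership
  immediate; \<open>span_singles\<close> identifies it with the span of the homogeneous
  elements.\<close>

definition galg_pos :: "'f::field galg set" where
  "galg_pos = {x. Poly_Mapping.lookup x 0 = 0}"

lemma galg_eqI:
  assumes "Poly_Mapping.lookup x 0 = Poly_Mapping.lookup y 0" "\<And>i. coord x i = coord y i"
  shows "x = (y :: 'f::field galg)"
  using assms by (intro poly_mapping_eqI) (metis gz_cases)

lemma so7_of_eqD:
  assumes "so7_of x = so7_of (y :: 'f::field galg)"
  shows "coord x i = coord y i"
proof -
  have "coord x i $ 1 = coord y i $ 1" "coord x i $ 2 = coord y i $ 2" "coord x i $ 3 = coord y i $ 3"
    \<comment> \<open>The columns solve \<open>q + 3 = i\<close>, \<open>q + 6 = i\<close> and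
      \<open>q + 5 = i\<close> modulo 7, one for each coordinate.\<close>
    using so7_of_entries[of x "i + 4"] so7_of_entries[of y "i + 4"]
      so7_of_entries[of x "i + 1"] so7_of_entries[of y "i + 1"]
      so7_of_entries[of x "i + 2"] so7_of_entries[of y "i + 2"] assms
    by (simp_all add: add.assoc numeral_7)
  then show ?thesis by (simp add: vec_eq_iff forall_3)
qed

lemma so7_of_inj_on: "inj_on so7_of galg_pos"
  by (rule inj_onI, rule galg_eqI) (auto simp: galg_pos_def dest: so7_of_eqD)

lemma so7_of_image:
  assumes two: "(2 :: 'f::field) \<noteq> 0"
  shows "so7_of ` galg_pos = (so7 :: ('f ^ 7 ^ 7) set)"
proof
  show "so7 \<subseteq> so7_of ` (galg_pos :: 'f galg set)"
  proof
    fix A :: "'f ^ 7 ^ 7" assume A: "A \<in> so7"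
    define v :: "7 \<Rightarrow> 'f ^ 3" where
      "v i = vector [A $ (i + 3) $ (i + 1), A $ (i + 6) $ (i + 2), A $ (i + 5) $ (i + 4)]" for i
    define x where "x = (\<Sum>i\<in>UNIV. Poly_Mapping.single (gz i) (v i))"
    have x: "coord x i = v i" "Poly_Mapping.lookup x 0 = 0" for i
      by (simp_all add: x_def lookup_sum lookup_single when_def inj_gz gz_nonzero)
    have "so7_of x = A"
      by (rule so7_eqI[OF two so7_of_in_so7 A])
        (simp_all add: so7_of_entries x v_def add.assoc numeral_7)
    then show "A \<in> so7_of ` galg_pos" using x by (auto simp: galg_pos_def)
  qed
qed (auto simp: so7_of_in_so7)

section \<open>Lie axioms, homogeneous elements and the derived algebra\<close>

lemma galg_bracket_pos: "galg_bracket x y \<in> galg_pos"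
  by (simp add: galg_pos_def lookup_bracket_0)

lemma galg_pos_eq_iff:
  "x \<in> galg_pos \<Longrightarrow> y \<in> galg_pos \<Longrightarrow> x = y \<longleftrightarrow> so7_of x = so7_of y"
  using so7_of_inj_on by (auto dest: inj_onD)

lemma subspace_galg_pos: "module.subspace galg_scale (galg_pos :: 'f::field galg set)"
proof -
  interpret vector_space galg_scale by (rule vector_space_galg_scale)
  show ?thesis
    by (rule subspaceI) (simp_all add: galg_pos_def lookup_add lookup_gga_scale)
qed

text \<open>Each axiom on the bracket equates elements of \<open>galg_pos\<close>, where
  \<open>so7_of\<close> is injective, so it reduces to the axiom for commutators. A general
  \<open>L\<close> covers both the whole algebra and \<open>galg_pos\<close>.\<close>

lemma lie_algebra_galg:
  assumes two: "(2 :: 'f::field) \<noteq> 0" and L: "module.subspace galg_scale (L :: 'f galg set)"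
    "galg_pos \<subseteq> L"
  shows "lie_algebra_on galg_scale L galg_bracket"
proof -
  interpret vector_space galg_scale by (rule vector_space_galg_scale)
  note add = subspace_add[OF subspace_galg_pos] and scale = subspace_scale[OF subspace_galg_pos]
    and zero = subspace_0[OF subspace_galg_pos]
  show ?thesis
  proof
    show "galg_bracket x y \<in> L" for x y
      using galg_bracket_pos L(2) by blast
  qed (simp_all only: L galg_pos_eq_iff galg_bracket_pos add scale zero so7_of_bracket[OF two]
      so7_of_linear commutator_bilinear commutator_jacobi so7_of_0,
      simp add: commutator_def)
qed

text \<open>With first argument (1,0,0), \<open>tau1\<close> puts the second entry of
  \<open>b\<close> into the third place; with (0,-1,0) it gives \<open>b\<close> the form (b1, b3,
  0). Together they reach every \<open>r\<close>.\<close>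

lemma single_gz_eq_bracket_sum:
  "Poly_Mapping.single (gz i) r =
    galg_bracket (Poly_Mapping.single (gz (i + 4)) (vector [1, 0, 0]))
      (Poly_Mapping.single (gz (i + 5)) (vector [0, r $ 3, 0]))
    + galg_bracket (Poly_Mapping.single (gz (i + 4)) (vector [0, - 1, 0]))
      (Poly_Mapping.single (gz (i + 5)) (vector [r $ 1, 0, r $ 2] :: 'f::field ^ 3))"
proof -
  have "gz (i + 4) + gz (i + 5) = gz i"
    using gz_add_1[of "i + 4"] by (simp add: add.assoc numeral_7)
  moreover have "twist (gz (i + 4)) (gz (i + 5)) a b = tau1 a b" for a b :: "'f ^ 3"
    using twist_gz(2)[of "i + 4"] by (simp add: add.assoc)
  ultimately have "galg_bracket (Poly_Mapping.single (gz (i + 4)) a) (Poly_Mapping.single (gz (i + 5)) b)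
      = Poly_Mapping.single (gz i) (tau1 a b)" for a b :: "'f ^ 3"
    by (simp only: gga_mult_single[OF bilinear_twist])
  moreover have "r = tau1 (vector [1, 0, 0]) (vector [0, r $ 3, 0])
      + tau1 (vector [0, - 1, 0]) (vector [r $ 1, 0, r $ 2])"
    by (simp add: vec_eq_iff forall_3 tau_components)
  ultimately show ?thesis by (metis single_add)
qed

lemma galg_pos_expand:
  assumes "x \<in> galg_pos"
  shows "x = (\<Sum>i\<in>UNIV. Poly_Mapping.single (gz i) (coord x i))"
  using assms
  by (intro galg_eqI) (simp_all add: galg_pos_def lookup_sum lookup_single when_def inj_gz gz_nonzero)

lemma span_singles:
  "module.span galg_scale {Poly_Mapping.single (gelt i) r | i r. i \<in> {1..7}} =
    (galg_pos :: 'f::field galg set)" (is "module.span _ ?S = _")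
proof -
  interpret vector_space galg_scale by (rule vector_space_galg_scale)
  have S: "?S = {Poly_Mapping.single (gz i) r | i r. True}"
  proof -
    have "?S = {Poly_Mapping.single g r | g r. g \<in> gelt ` {1..7}}" by blast
    then show ?thesis unfolding image_gelt by blast
  qed
  show ?thesis
  proof (rule span_unique)
    show "?S \<subseteq> galg_pos"
      unfolding S by (auto simp: galg_pos_def lookup_single when_def gz_nonzero)
    show "galg_pos \<subseteq> M" if M: "?S \<subseteq> M" "subspace M" for M
    proof
      fix x :: "'f galg" assume "x \<in> galg_pos"
      then show "x \<in> M"
        by (subst galg_pos_expand) (use M(1)[unfolded S] in \<open>auto intro!: subspace_sum[OF M(2)]\<close>)
    qed
  qed (rule subspace_galg_pos)
qed

text \<open>Brackets have no component in degree 0; conversely every homogeneous element of nonzero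
  degree is a sum of two brackets.\<close>

lemma derived_galg:
  "derived_algebra galg_scale (UNIV :: 'f::field galg set) galg_bracket = galg_pos"
  unfolding derived_algebra_def
proof -
  interpret vector_space galg_scale by (rule vector_space_galg_scale)
  show "span {galg_bracket x y | x y. x \<in> UNIV \<and> y \<in> UNIV} = (galg_pos :: 'f galg set)"
  proof (rule span_unique)
    show "galg_pos \<subseteq> M" if M: "{galg_bracket x y | x y. x \<in> UNIV \<and> y \<in> UNIV} \<subseteq> M" "subspace M"
      for M :: "'f galg set"
    proof
      fix x :: "'f galg" assume "x \<in> galg_pos"
      have "Poly_Mapping.single (gz i) r \<in> M" for i r
        by (subst single_gz_eq_bracket_sum, rule subspace_add) (use M in auto)
      then show "x \<in> M"
        by (subst galg_pos_expand[OF \<open>x \<in> galg_pos\<close>]) (auto intro!: subspace_sum[OF M(2)])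
    qed
  qed (auto simp: galg_bracket_pos subspace_galg_pos)
qed

section \<open>Simplicity, center and isomorphism\<close>

definition elem_skew :: "'n::finite \<Rightarrow> 'n \<Rightarrow> 'f::field ^ 'n ^ 'n" where
  "elem_skew p q = (\<chi> i j. of_bool (i = p \<and> j = q) - of_bool (i = q \<and> j = p))"

lemma commutator_elem_skew:
  "commutator A (elem_skew p q) $ i $ j =
    of_bool (j = q) * A $ i $ p - of_bool (j = p) * A $ i $ q
    - of_bool (i = p) * A $ q $ j + of_bool (i = q) * A $ p $ j"
proof -
  have "commutator A (elem_skew p q) $ i $ j =
    (\<Sum>r\<in>UNIV. (if r = p then of_bool (j = q) * A $ i $ p else 0)
      - (if r = q then of_bool (j = p) * A $ i $ q else 0)
      - (if r = q then of_bool (i = p) * A $ q $ j else 0)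
      + (if r = p then of_bool (i = q) * A $ p $ j else 0))"
    unfolding commutator_component by (intro sum.cong) (auto simp: elem_skew_def)
  then show ?thesis by (simp add: sum.distrib sum_subtractf)
qed

lemma commutator_elem_skew_elem_skew:
  assumes "p \<noteq> q" "q \<noteq> r" "p \<noteq> r"
  shows "commutator (elem_skew p q) (elem_skew q r) = elem_skew p r"
  using assms by (auto simp: vec_eq_iff commutator_elem_skew) (auto simp: elem_skew_def)

text \<open>Bracketing with \<open>elem_skew p r\<close> keeps only the rows and columns \<open>p\<close>, \<open>r\<close>
  of \<open>A\<close> and exchanges them; four such steps isolate a single entry, without any division.\<close>

lemma commutator4_elem_skew:
  assumes A: "A \<in> so7" and d: "distinct [p, q, r, s, t, u]"
  shows "commutator (commutator (commutator (commutator A (elem_skew p r)) (elem_skew q s))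
    (elem_skew r t)) (elem_skew s u) = mat_scale (A $ p $ q) (elem_skew t u)"
proof -
  have neq: "p \<noteq> q" "p \<noteq> r" "p \<noteq> s" "p \<noteq> t" "p \<noteq> u" "q \<noteq> r" "q \<noteq> s" "q \<noteq> t" "q \<noteq> u"
    "r \<noteq> s" "r \<noteq> t" "r \<noteq> u" "s \<noteq> t" "s \<noteq> u" "t \<noteq> u"
    using d by auto
  define B where "B = commutator A (elem_skew p r)"
  define C where "C = commutator B (elem_skew q s)"
  define D where "D = commutator C (elem_skew r t)"
  note simps = commutator_elem_skew neq neq[symmetric]
  have skew: "A $ q $ p = - A $ p $ q" using A unfolding in_so7_iff by blast
  \<comment> \<open>Only entries read by later brackets are recorded. The value
    \<open>A $ p $ q\<close> travels from position (p,q) to (r,q), (r,s), (t,s) and finally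
    (t,u).\<close>
  have B: "B $ r $ q = A $ p $ q" "B $ t $ q = 0" "B $ q $ r = - A $ p $ q" "B $ q $ t = 0"
    by (simp_all add: B_def simps skew)
  have C: "C $ r $ s = A $ p $ q" "C $ s $ r = - A $ p $ q" "C $ t $ s = 0" "C $ s $ t = 0"
    "C $ r $ u = 0" "C $ u $ r = 0" "C $ t $ u = 0" "C $ u $ t = 0"
    by (simp_all add: C_def simps B)
  have D: "D $ i $ s = of_bool (i = t) * A $ p $ q" "D $ s $ j = - of_bool (j = t) * A $ p $ q"
    "D $ i $ u = 0" "D $ u $ j = 0" for i j
    by (simp_all add: D_def simps C)
  have "commutator D (elem_skew s u) = mat_scale (A $ p $ q) (elem_skew t u)"
    by (simp add: vec_eq_iff commutator_elem_skew D mat_scale_def)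
      (auto simp: elem_skew_def neq)
  then show ?thesis by (simp only: B_def C_def D_def)
qed

lemma elem_skew_in_so7: "elem_skew p q \<in> so7"
  unfolding in_so7_iff by (simp add: elem_skew_def conj_commute)

lemma elem_skew_swap: "elem_skew q p = mat_scale (- 1) (elem_skew p q)"
  by (simp add: vec_eq_iff mat_scale_def elem_skew_def)

text \<open>Isolating an entry takes six distinct indices, and seven are available.\<close>

lemma ex_distinct_indices:
  fixes p q :: 7
  assumes "p \<noteq> q"
  obtains r s t u where "distinct [p, q, r, s, t, u]"
proof -
  have ex: "\<exists>x::7. x \<notin> set xs" if "length xs < 7" for xs
  proof -
    have "card (set xs) < CARD(7)"
      using le_less_trans[OF card_length that] by simp
    then have "set xs \<noteq> UNIV" by (metis less_irrefl)
    then show ?thesis by blast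
  qed
  have "\<exists>r. r \<notin> set [p, q]" by (rule ex) simp
  then obtain r where "r \<notin> set [p, q]" ..
  moreover have "\<exists>s. s \<notin> set [p, q, r]" by (rule ex) simp
  then obtain s where "s \<notin> set [p, q, r]" ..
  moreover have "\<exists>t. t \<notin> set [p, q, r, s]" by (rule ex) simp
  then obtain t where "t \<notin> set [p, q, r, s]" ..
  moreover have "\<exists>u. u \<notin> set [p, q, r, s, t]" by (rule ex) simp
  then obtain u where "u \<notin> set [p, q, r, s, t]" ..
  ultimately have "distinct [p, q, r, s, t, u]"
    using assms by (simp add: eq_commute)
  then show ?thesis by (rule that)
qed

text \<open>The offsets 1, 2, 4 meet each unordered pair of distinct indices once, so no factor 1/2
  appears.\<close>

lemma so7_expand:
  assumes two: "(2 :: 'f::field) \<noteq> 0" and A: "(A :: 'f ^ 7 ^ 7) \<in> so7"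
  shows "A = (\<Sum>q\<in>UNIV. mat_scale (A $ (q + 1) $ q) (elem_skew (q + 1) q)
    + mat_scale (A $ (q + 2) $ q) (elem_skew (q + 2) q)
    + mat_scale (A $ (q + 4) $ q) (elem_skew (q + 4) q))" (is "A = ?B")
proof (rule so7_eqI[OF two A])
  interpret so7: lie_algebra_on mat_scale "so7 :: ('f ^ 7 ^ 7) set" commutator
    by (rule lie_algebra_so7)
  show "?B \<in> so7"
    by (intro so7.subspace_sum so7.subspace_add so7.subspace_scale so7.subspace_L elem_skew_in_so7)
  fix q :: 7
  have B: "?B $ i $ j = (\<Sum>q\<in>UNIV. A $ (q + 1) $ q * elem_skew (q + 1) q $ i $ j
      + A $ (q + 2) $ q * elem_skew (q + 2) q $ i $ j
      + A $ (q + 4) $ q * elem_skew (q + 4) q $ i $ j)" for i j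
    by (simp add: mat_scale_def)
  show "A $ (q + 1) $ q = ?B $ (q + 1) $ q" "A $ (q + 2) $ q = ?B $ (q + 2) $ q"
    "A $ (q + 4) $ q = ?B $ (q + 4) $ q"
    unfolding B unfolding sum_7[of _ q] by (simp_all add: elem_skew_def add.assoc numeral_7)
qed

text \<open>A nonzero entry of \<open>A\<close> yields a nonzero multiple of some
  \<open>elem_skew t u\<close>. After division by that entry, brackets along a shared index replace
  first \<open>u\<close> and then \<open>t\<close>, until \<open>K\<close> contains all elementary
  skew matrices, which span \<open>so7\<close>.\<close>

lemma commutator_invariant_subspace_so7:
  assumes two: "(2 :: 'f::field) \<noteq> 0"
    and K: "module.subspace mat_scale (K :: ('f ^ 7 ^ 7) set)" "K \<subseteq> so7"
    and comm: "\<And>A B. A \<in> K \<Longrightarrow> B \<in> so7 \<Longrightarrow> commutator A B \<in> K"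
    and A: "A \<in> K" "A \<noteq> 0"
  shows "K = so7"
proof
  interpret vector_space "mat_scale :: 'f \<Rightarrow> 'f ^ 7 ^ 7 \<Rightarrow> 'f ^ 7 ^ 7"
    by (rule vector_space_mat_scale)
  note scale = subspace_scale[OF K(1)]
  obtain p q where pq: "A $ p $ q \<noteq> 0" using A(2) by (auto simp: vec_eq_iff)
  then have "p \<noteq> q" using so7_diag[OF two] A(1) K(2) by blast
  then obtain r s t u where d: "distinct [p, q, r, s, t, u]"
    by (rule ex_distinct_indices)
  have "mat_scale (A $ p $ q) (elem_skew t u) \<in> K"
    unfolding commutator4_elem_skew[OF subsetD[OF K(2) A(1)] d, symmetric]
    by (intro comm A elem_skew_in_so7)
  from scale[OF this, of "inverse (A $ p $ q)"] have tu: "elem_skew t u \<in> K"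
    using pq by simp
  have tw: "elem_skew t w \<in> K" if "t \<noteq> w" for w
  proof (cases "u = w")
    case False
    have "commutator (elem_skew t u) (elem_skew u w) \<in> K"
      by (intro comm tu elem_skew_in_so7)
    then show ?thesis
      using that False d by (simp add: commutator_elem_skew_elem_skew)
  qed (use tu in simp)
  have wt: "elem_skew w t \<in> K" if "t \<noteq> w" for w
    using scale[OF tw[OF that], of "- 1"] by (simp only: elem_skew_swap[symmetric])
  have vw: "elem_skew v w \<in> K" if "v \<noteq> w" for v w
  proof (cases "v = t \<or> w = t")
    case True
    then show ?thesis using that tw wt by auto
  next
    case False
    have "commutator (elem_skew v t) (elem_skew t w) \<in> K"
      using False by (intro comm wt elem_skew_in_so7) auto
    moreover have "commutator (elem_skew v t) (elem_skew t w) = (elem_skew v w :: 'f ^ 7 ^ 7)"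
      using that False by (intro commutator_elem_skew_elem_skew) auto
    ultimately show ?thesis by simp
  qed
  show "so7 \<subseteq> K"
  proof
    fix B :: "'f ^ 7 ^ 7" assume "B \<in> so7"
    then show "B \<in> K"
      by (subst so7_expand[OF two]) (auto intro!: subspace_sum subspace_add K(1) scale vw)
  qed
qed (rule K(2))

text \<open>If \<open>A\<close> commutes with \<open>so7\<close>, already the first of the four
  brackets in \<open>commutator4_elem_skew\<close> is 0, whereas a nonzero entry would make the last
  one nonzero.\<close>

lemma centralizer_so7:
  assumes two: "(2 :: 'f::field) \<noteq> 0" and A: "(A :: 'f ^ 7 ^ 7) \<in> so7"
    and "\<And>B. B \<in> so7 \<Longrightarrow> commutator A B = 0"
  shows "A = 0"
proof (rule ccontr)
  assume "A \<noteq> 0"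
  then obtain p q where pq: "A $ p $ q \<noteq> 0" by (auto simp: vec_eq_iff)
  then have "p \<noteq> q" using so7_diag[OF two A, of p] by auto
  then obtain r s t u where d: "distinct [p, q, r, s, t, u]"
    by (rule ex_distinct_indices)
  have "commutator 0 B = 0" for B :: "'f ^ 7 ^ 7" by (simp add: commutator_def)
  moreover have "commutator A (elem_skew p r) = 0"
    by (intro assms(3) elem_skew_in_so7)
  ultimately have "mat_scale (A $ p $ q) (elem_skew t u) = 0"
    by (subst commutator4_elem_skew[OF A d, symmetric]) simp
  then have "mat_scale (A $ p $ q) (elem_skew t u) $ t $ u = 0" by simp
  moreover have "t \<noteq> u" using d by simp
  ultimately show False using pq by (simp add: mat_scale_def elem_skew_def)
qed

section \<open>Transfer of the structural results to the group algebra\<close>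

lemma simple_galg_pos:
  assumes two: "(2 :: 'f::field) \<noteq> 0"
  shows "simple_lie_algebra galg_scale (galg_pos :: 'f galg set) galg_bracket"
proof -
  interpret vector_space "galg_scale :: 'f \<Rightarrow> 'f galg \<Rightarrow> 'f galg"
    by (rule vector_space_galg_scale)
  interpret so7: vector_space "mat_scale :: 'f \<Rightarrow> 'f ^ 7 ^ 7 \<Rightarrow> 'f ^ 7 ^ 7"
    by (rule vector_space_mat_scale)
  have "J = {0} \<or> J = galg_pos" if "lie_ideal galg_scale galg_pos galg_bracket J" for J :: "'f galg set"
  proof (rule disjCI)
    have J: "J \<subseteq> galg_pos" "subspace J" "\<And>x y. x \<in> galg_pos \<Longrightarrow> y \<in> J \<Longrightarrow> galg_bracket x y \<in> J"
      using that by (auto simp: lie_ideal_def)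
    assume "J \<noteq> galg_pos"
    have "x = 0" if x: "x \<in> J" for x
    proof (rule ccontr)
      assume "x \<noteq> 0"
      then have nz: "so7_of x \<noteq> 0"
        using galg_pos_eq_iff[of x 0] x J(1) subspace_0[OF subspace_galg_pos] so7_of_0 by auto
      have "so7_of ` J = so7"
      proof (rule commutator_invariant_subspace_so7[where A = "so7_of x", OF two])
        show "so7.subspace (so7_of ` J)"
        proof (rule so7.subspaceI)
          show "0 \<in> so7_of ` J" using so7_of_0 subspace_0[OF J(2)] by (metis imageI)
        next
          fix A B assume "A \<in> so7_of ` J" "B \<in> so7_of ` J"
          then show "A + B \<in> so7_of ` J"
            using subspace_add[OF J(2)] by (auto simp: so7_of_linear[symmetric])
        next
          fix c A assume "A \<in> so7_of ` J"
          then show "mat_scale c A \<in> so7_of ` J"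
            using subspace_scale[OF J(2)] by (auto simp: so7_of_linear[symmetric])
        qed
        show "so7_of ` J \<subseteq> so7" using so7_of_in_so7 by blast
        show "so7_of x \<in> so7_of ` J" "so7_of x \<noteq> 0" using x nz by auto
      next
        fix A B :: "'f ^ 7 ^ 7" assume "A \<in> so7_of ` J" "B \<in> so7"
        then obtain a b where ab: "a \<in> J" "A = so7_of a" "b \<in> galg_pos" "B = so7_of b"
          unfolding so7_of_image[OF two, symmetric] by blast
        \<comment> \<open>Ideals absorb brackets from the left, the invariance lemma asks for the
          right; the sign is absorbed by the subspace.\<close>
        have "commutator A B = mat_scale (- 1) (commutator B A)"
          by (simp add: commutator_def mat_scale_def vec_eq_iff)
        also have "\<dots> = so7_of (galg_scale (- 1) (galg_bracket b a))"
          by (simp only: ab so7_of_linear so7_of_bracket[OF two])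
        finally show "commutator A B \<in> so7_of ` J"
          using subspace_scale[OF J(2) J(3)[OF ab(3,1)]] by (simp only: imageI)
      qed
      then have "so7_of ` J = so7_of ` galg_pos" by (simp add: so7_of_image[OF two])
      then have "J = galg_pos"
        by (simp only: inj_on_image_eq_iff[OF so7_of_inj_on J(1) order_refl])
      then show False using \<open>J \<noteq> galg_pos\<close> by simp
    qed
    then show "J = {0}" using subspace_0[OF J(2)] by blast
  qed
  moreover have "\<exists>x\<in>galg_pos. \<exists>y\<in>galg_pos. galg_bracket x y \<noteq> (0 :: 'f galg)"
  proof (rule ccontr)
    assume "\<not> ?thesis"
    then have z: "commutator A B = 0" if "A \<in> so7" "B \<in> so7" for A B :: "'f ^ 7 ^ 7"
      using that unfolding so7_of_image[OF two, symmetric]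
      by (auto simp: so7_of_bracket[OF two, symmetric] so7_of_0)
    \<comment> \<open>Were all brackets zero, every skew matrix would centralize \<open>so7\<close>
      and hence vanish.\<close>
    have "elem_skew 0 1 = (0 :: 'f ^ 7 ^ 7)"
      using centralizer_so7[OF two elem_skew_in_so7] z elem_skew_in_so7 by blast
    then have "elem_skew 0 1 $ (0::7) $ (1::7) = (0 :: 'f)" by simp
    then show False by (simp add: elem_skew_def)
  qed
  ultimately show ?thesis
    using lie_algebra_galg[OF two subspace_galg_pos] by (simp add: simple_lie_algebra_def)
qed

text \<open>Since \<open>so7_of\<close> maps onto \<open>so7\<close>, a central \<open>x\<close> has
  an image that centralizes \<open>so7\<close>, hence image 0, and only its degree 0 part remains.
  Conversely, products read only coordinates of nonzero degree.\<close>

lemma center_galg: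
  assumes two: "(2 :: 'f::field) \<noteq> 0"
  shows "lie_center (UNIV :: 'f galg set) galg_bracket = range (Poly_Mapping.single 0)"
proof (intro equalityI subsetI)
  fix x :: "'f galg" assume "x \<in> lie_center UNIV galg_bracket"
  then have x: "galg_bracket x y = 0" for y by (simp add: lie_center_def)
  have "so7_of x = 0"
  proof (rule centralizer_so7[OF two so7_of_in_so7])
    fix B :: "'f ^ 7 ^ 7" assume "B \<in> so7"
    then obtain b where "B = so7_of b" unfolding so7_of_image[OF two, symmetric] by blast
    then show "commutator (so7_of x) B = 0"
      by (simp add: so7_of_bracket[OF two, symmetric] x so7_of_0)
  qed
  then have c: "coord x i = 0" for i
    using so7_of_eqD[of x 0 i] by (simp add: so7_of_0)
  have "x = Poly_Mapping.single 0 (Poly_Mapping.lookup x 0)"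
    by (rule galg_eqI) (simp_all add: lookup_single_not_eq gz_nonzero[symmetric] c)
  then show "x \<in> range (Poly_Mapping.single 0)" by blast
next
  fix x :: "'f galg" assume "x \<in> range (Poly_Mapping.single 0)"
  then obtain r where "x = Poly_Mapping.single 0 r" by blast
  then have c: "coord x i = 0" for i
    by (simp add: lookup_single_not_eq gz_nonzero[symmetric])
  have tau: "tau1 0 b = 0" "tau1 b 0 = 0" "tau2 0 b = 0" "tau2 b 0 = 0" "tau4 0 b = 0" "tau4 b 0 = 0"
    for b :: "'f ^ 3"
    by (simp_all add: vec_eq_iff forall_3 tau_components)
  have "galg_bracket x y = 0" for y
    by (rule galg_eqI) (simp_all add: lookup_bracket_0 coord_bracket half_bracket_def c tau)
  then show "x \<in> lie_center UNIV galg_bracket" by (simp add: lie_center_def)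
qed

lemma dim_range_single:
  "vector_space.dim galg_scale (range (Poly_Mapping.single 0 :: 'f::field ^ 3 \<Rightarrow> 'f galg)) = 3"
proof -
  interpret galg: vector_space "galg_scale :: 'f \<Rightarrow> 'f galg \<Rightarrow> 'f galg"
    by (rule vector_space_galg_scale)
  interpret pair: finite_dimensional_vector_space_pair_1
    "(*s) :: 'f \<Rightarrow> 'f ^ 3 \<Rightarrow> 'f ^ 3" cart_basis "galg_scale :: 'f \<Rightarrow> 'f galg \<Rightarrow> 'f galg"
    by unfold_locales
  have "Vector_Spaces.linear (*s) galg_scale (Poly_Mapping.single 0 :: 'f ^ 3 \<Rightarrow> 'f galg)"
    by (simp add: Vector_Spaces.linear_iff vec.vector_space_axioms galg.vector_space_axioms
        single_add poly_mapping_eq_iff fun_eq_iff lookup_gga_scale lookup_single when_def)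
  moreover have "inj_on (Poly_Mapping.single 0 :: 'f ^ 3 \<Rightarrow> 'f galg) (vec.span UNIV)"
    by (metis inj_onI lookup_single_eq)
  ultimately have "galg.dim (range (Poly_Mapping.single 0 :: 'f ^ 3 \<Rightarrow> 'f galg))
      = vec.dim (UNIV :: ('f ^ 3) set)"
    by (rule pair.dim_image_eq)
  also have "\<dots> = CARD(3)" by (rule vec_dim_card)
  finally show ?thesis by simp
qed

lemma isomorphic_galg_pos_so7:
  assumes two: "(2 :: 'f::field) \<noteq> 0"
  shows "lie_isomorphic galg_scale (galg_pos :: 'f galg set) galg_bracket mat_scale so7 commutator"
  unfolding lie_isomorphic_def bij_betw_def
  by (intro conjI exI[of _ so7_of] ballI allI lie_algebra_galg[OF two subspace_galg_pos] order_refl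
      lie_algebra_so7 so7_of_inj_on so7_of_image[OF two] so7_of_linear so7_of_bracket[OF two])

theorem corollary2p4:
  assumes "CHAR('f::field) \<noteq> 2" and "CHAR('f) \<noteq> 3"
  shows "lie_algebra_on galg_scale (UNIV :: 'f galg set) galg_bracket \<and>
    lie_center (UNIV :: 'f galg set) galg_bracket = {Poly_Mapping.single (gelt 0) r | r. True} \<and>
    vector_space.dim galg_scale (lie_center (UNIV :: 'f galg set) galg_bracket) = 3 \<and>
    derived_algebra galg_scale (UNIV :: 'f galg set) galg_bracket =
           module.span galg_scale {Poly_Mapping.single (gelt i) r | i r. i \<in> {1..7}} \<and>
    simple_lie_algebra galg_scale
           (derived_algebra galg_scale (UNIV :: 'f galg set) galg_bracket) galg_bracket \<and>
    lie_isomorphic galg_scale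
           (derived_algebra galg_scale (UNIV :: 'f galg set) galg_bracket) galg_bracket
           mat_scale so7 commutator"
proof -
  have two: "(2 :: 'f) \<noteq> 0"
  proof
    assume "(2 :: 'f) = 0"
    then have "CHAR('f) dvd 2"
      \<comment> \<open>The divisors of 2 are 1 and 2, and a field does not have characteristic
        1.\<close>
      by (simp add: of_nat_eq_0_iff_char_dvd[symmetric])
    then have "CHAR('f) \<le> 2" by (rule dvd_imp_le) simp
    moreover have "CHAR('f) \<noteq> 0" using \<open>CHAR('f) dvd 2\<close> by (metis dvd_0_left zero_neq_numeral)
    moreover have "CHAR('f) \<noteq> 1" using CHAR_not_1[where 'a = 'f] by simp
    ultimately show False using assms(1) by linarith
  qed
  have "lie_algebra_on galg_scale (UNIV :: 'f galg set) galg_bracket"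
    by (rule lie_algebra_galg[OF two]) (simp_all add: module.subspace_UNIV vector_space_galg_scale
        module_iff_vector_space)
  moreover have "range (Poly_Mapping.single 0 :: 'f ^ 3 \<Rightarrow> 'f galg)
      = {Poly_Mapping.single (gelt 0) r | r. True}"
    by (auto simp: gelt_zero)
  ultimately show ?thesis
    using center_galg[OF two] dim_range_single[where 'f = 'f]
      derived_galg[where 'f = 'f] span_singles[where 'f = 'f] simple_galg_pos[OF two] isomorphic_galg_pos_so7[OF two]
    by simp
qed

end
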